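(* Suppose $\operatorname{char}(K)=0$. Let $G$ be a finite group and let $R$ be a finite-dimensional $G$-graded regular algebra with commutation function $\theta$. Then there exists a $2$-cocycle $\alpha\in Z^2(G,K^* )$ such that $K^\alpha G$ is (isomorphic to) a subalgebra of $R$.
   Context: $K$ is an algebraically closed field; all algebras are unital associative $K$-algebras. For $\mathbf{g}=(g_1,\dots,g_n)\in G^n$ let $S_{n,\mathbf{g}}$ be the set of permutations $\sigma\in S_n$ with $g_{\sigma(1)}\cdots g_{\sigma(n)}=g_1\cdots g_n$. A $G$-graded algebra $R=\bigoplus_{g\in G}R_g$ (i.e. $R_gR_h\subseteq R_{gh}$) is a $G$-graded regular algebra if: (1) for every $n\in\mathbb{N}$ and $(g_1,\dots,g_n)\in G^n$ there exist $a_i\in R_{g_i}$, $1\le i\le n$, with $a_1\cdots a_n\neq 0$; (2) for every $n\in\mathbb{N}$, $\mathbf{g}=(g_1,\dots,g_n)\in G^n$ and $\sigma\in S_{n,\mathbf{g}}$ there exists $\theta(\mathbf{g},\sigma)\in K^*$ such that $a_1\cdots a_n=\theta(\mathbf{g},\sigma)\,a_{\sigma(1)}\cdots a_{\sigma(n)}$ for all $a_i\in R_{g_i}$. The function $\theta$ is the commutation function of $R$. $Z^2(G,K^* )$ is the group of $2$-cocycles $\alpha\colon G\times G\to K^*$ for the trivial action, i.e. $\alpha(g,h)\alpha(gh,k)=\alpha(g,hk)\alpha(h,k)$ for all $g,h,k\in G$. The twisted group algebra $K^\alpha G$ has $K$-basis $\{X_g\mid g\in G\}$ with product $X_gX_h=\alpha(g,h)X_{gh}$.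 *)

theory Defs
  imports
    "HOL-Algebra.Group"
    "HOL-Combinatorics.Permutations"
    "HOL-Computational_Algebra.Polynomial"
begin

section \<open>Graded regular algebras\<close>

locale K_algebra = vector_space scale
  for scale :: "'k::field \<Rightarrow> 'r::ring_1 \<Rightarrow> 'r" +
  assumes scale_mult_left: "scale c x * y = scale c (x * y)"
    and scale_mult_right: "x * scale c y = scale c (x * y)"
begin

text \<open>The unit of a subalgebra need not be the unit of the ambient algebra. For instance,
  \<open>M\<^sub>2(K) \<times> K\<close>, graded by the Klein four-group with \<open>M\<^sub>2(K)\<close> a twisted group algebra and \<open>K\<close> in
  degree 1, is graded regular, but it contains no four-dimensional twisted group algebra of the
  Klein four-group sharing its unit.\<close>

definition subalgebra :: "'r set \<Rightarrow> bool" where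
  "subalgebra S \<longleftrightarrow> subspace S \<and> (\<forall>x\<in>S. \<forall>y\<in>S. x * y \<in> S) \<and>
     (\<exists>e\<in>S. \<forall>x\<in>S. e * x = x \<and> x * e = x)"

end

locale graded_algebra = G: group G + K_algebra scale
  for G :: "('g, 'm) monoid_scheme" and scale :: "'k::field \<Rightarrow> 'r::ring_1 \<Rightarrow> 'r" +
  fixes R :: "'g \<Rightarrow> 'r set"
  assumes subspace_component: "g \<in> carrier G \<Longrightarrow> subspace (R g)"
    and direct_sum: "\<exists>!f. (\<forall>g\<in>carrier G. f g \<in> R g) \<and> (\<forall>g. g \<notin> carrier G \<longrightarrow> f g = 0) \<and>
      finite {g. f g \<noteq> 0} \<and> (\<Sum>g | f g \<noteq> 0. f g) = r"
    and component_mult: "\<lbrakk>g \<in> carrier G; h \<in> carrier G; x \<in> R g; y \<in> R h\<rbrakk> \<Longrightarrow> x * y \<in> R (g \<otimes>\<^bsub>G\<^esub> h)"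

text \<open>A tuple in \<open>G\<^sup>n\<close> is a list of length \<open>n\<close>, indexed from 0, and \<^term>\<open>permute_list \<sigma> gs\<close> has
  the entry \<^term>\<open>gs ! \<sigma> i\<close> at index \<open>i\<close>.\<close>

definition prod_perms :: "('g, 'm) monoid_scheme \<Rightarrow> 'g list \<Rightarrow> (nat \<Rightarrow> nat) set" where
  "prod_perms G gs = {\<sigma>. \<sigma> permutes {..<length gs} \<and>
     foldr (\<otimes>\<^bsub>G\<^esub>) (permute_list \<sigma> gs) \<one>\<^bsub>G\<^esub> = foldr (\<otimes>\<^bsub>G\<^esub>) gs \<one>\<^bsub>G\<^esub>}"

text \<open>Only the values of \<open>\<theta>\<close> at \<open>gs\<close> over \<^term>\<open>carrier G\<close> and \<^term>\<open>\<sigma> \<in> prod_perms G gs\<close> matter;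
  they are determined by the other data. The relation \<^term>\<open>list_all2 (\<lambda>a g. a \<in> R g) as gs\<close> says
  that \<open>as\<close> has the same length as \<open>gs\<close> and that its entries are homogeneous of the degrees
  listed in \<open>gs\<close>.\<close>

locale graded_regular_algebra = graded_algebra G scale R
  for G :: "('g, 'm) monoid_scheme" and scale :: "'k::field \<Rightarrow> 'r::ring_1 \<Rightarrow> 'r"
    and R :: "'g \<Rightarrow> 'r set" +
  fixes \<theta> :: "'g list \<Rightarrow> (nat \<Rightarrow> nat) \<Rightarrow> 'k"
  assumes ex_nonzero_product:
      "set gs \<subseteq> carrier G \<Longrightarrow> \<exists>as. list_all2 (\<lambda>a g. a \<in> R g) as gs \<and> prod_list as \<noteq> 0"
    and commutation_nonzero:
      "\<lbrakk>set gs \<subseteq> carrier G; \<sigma> \<in> prod_perms G gs\<rbrakk> \<Longrightarrow> \<theta> gs \<sigma> \<noteq> 0"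
    and commutation:
      "\<lbrakk>set gs \<subseteq> carrier G; \<sigma> \<in> prod_perms G gs; list_all2 (\<lambda>a g. a \<in> R g) as gs\<rbrakk>
       \<Longrightarrow> prod_list as = scale (\<theta> gs \<sigma>) (prod_list (permute_list \<sigma> as))"


section \<open>Twisted group algebras\<close>

definition two_cocycle :: "('g, 'm) monoid_scheme \<Rightarrow> ('g \<Rightarrow> 'g \<Rightarrow> 'k::field) \<Rightarrow> bool" where
  "two_cocycle G \<alpha> \<longleftrightarrow> (\<forall>g\<in>carrier G. \<forall>h\<in>carrier G. \<alpha> g h \<noteq> 0) \<and>
     (\<forall>g\<in>carrier G. \<forall>h\<in>carrier G. \<forall>k\<in>carrier G.
        \<alpha> g h * \<alpha> (g \<otimes>\<^bsub>G\<^esub> h) k = \<alpha> g (h \<otimes>\<^bsub>G\<^esub> k) * \<alpha> h k)"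

text \<open>An element \<open>\<Sum>\<^sub>g f(g) X\<^sub>g\<close> of the twisted group algebra is represented by its coefficient
  function \<open>f\<close>; addition and scalar multiplication are pointwise.\<close>

definition twisted_carrier :: "('g, 'm) monoid_scheme \<Rightarrow> ('g \<Rightarrow> 'k::field) set" where
  "twisted_carrier G = {f. finite {g. f g \<noteq> 0} \<and> {g. f g \<noteq> 0} \<subseteq> carrier G}"

definition twisted_mult ::
  "('g, 'm) monoid_scheme \<Rightarrow> ('g \<Rightarrow> 'g \<Rightarrow> 'k::field) \<Rightarrow> ('g \<Rightarrow> 'k) \<Rightarrow> ('g \<Rightarrow> 'k) \<Rightarrow> 'g \<Rightarrow> 'k" where
  "twisted_mult G \<alpha> f f' = (\<lambda>k. \<Sum>(g, h) | f g \<noteq> 0 \<and> f' h \<noteq> 0 \<and> g \<otimes>\<^bsub>G\<^esub> h = k. f g * f' h * \<alpha> g h)"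

definition twisted_basis :: "'g \<Rightarrow> 'g \<Rightarrow> 'k::field" where
  "twisted_basis g = (\<lambda>x. if x = g then 1 else 0)"

lemma twisted_mult_basis:
  fixes \<alpha> :: "'g \<Rightarrow> 'g \<Rightarrow> 'k::field"
  shows "twisted_mult G \<alpha> (twisted_basis g) (twisted_basis h) = (\<lambda>x. \<alpha> g h * twisted_basis (g \<otimes>\<^bsub>G\<^esub> h) x)"
proof
  fix x
  have "{(a, b). twisted_basis g a \<noteq> (0::'k) \<and> twisted_basis h b \<noteq> (0::'k) \<and> a \<otimes>\<^bsub>G\<^esub> b = x} =
      (if x = g \<otimes>\<^bsub>G\<^esub> h then {(g, h)} else {})"
    by (auto simp: twisted_basis_def)
  then show "twisted_mult G \<alpha> (twisted_basis g) (twisted_basis h) x =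
      \<alpha> g h * twisted_basis (g \<otimes>\<^bsub>G\<^esub> h) x"
    unfolding twisted_mult_def by (simp add: twisted_basis_def)
qed

definition (in K_algebra) twisted_group_algebra_iso ::
  "('g, 'm) monoid_scheme \<Rightarrow> ('g \<Rightarrow> 'g \<Rightarrow> 'k) \<Rightarrow> 'r set \<Rightarrow> (('g \<Rightarrow> 'k) \<Rightarrow> 'r) \<Rightarrow> bool" where
  "twisted_group_algebra_iso G \<alpha> S \<phi> \<longleftrightarrow> bij_betw \<phi> (twisted_carrier G) S \<and>
     (\<forall>f\<in>twisted_carrier G. \<forall>f'\<in>twisted_carrier G.
        \<phi> (\<lambda>g. f g + f' g) = \<phi> f + \<phi> f' \<and> \<phi> (twisted_mult G \<alpha> f f') = \<phi> f * \<phi> f') \<and>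
     (\<forall>c. \<forall>f\<in>twisted_carrier G. \<phi> (\<lambda>g. c * f g) = scale c (\<phi> f))"

end

theory Submission
  imports Defs "HOL-Algebra.Multiplicative_Group"
begin

text \<open>
  Because the unit is homogeneous of degree 1, the commutation rule makes the component \<open>R\<^sub>1\<close> a
  central subalgebra. The idea is to cut \<open>R\<close> down by an idempotent \<open>e\<close> of \<open>R\<^sub>1\<close> to a piece in which
  every degree contains an invertible element and the degree-1 part is local, and then to
  normalise these invertible elements until their products differ by scalars only.

  Multiplication by a central nilpotent element strictly lowers the dimension of a nonzero
  principal right ideal, so a product of more such elements than the dimension of \<open>R\<close> vanishes
  (\<open>prod_central_nilpotents_eq_0\<close>). Regularity, however, provides nonzero products of arbitrarily
  many blocks of homogeneous factors, each block containing a factor of every degree and having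
  total degree 1. Hence some block has a product \<open>b\<close> in \<open>R\<^sub>1\<close> that is not nilpotent. Fitting
  decompositions and the existence of eigenvalues give an idempotent \<open>e\<close> modulo whose complement
  \<open>b\<close> is invertible, and such that every element of \<open>e R\<^sub>1\<close> is a multiple of \<open>e\<close> plus a nilpotent
  element (\<open>ex_local_idempotent\<close>). As \<open>b\<close> has a factor \<open>a\<close> of each degree \<open>g\<close>, every degree contains
  an invertible element of \<open>e R\<close>.

  Let \<open>n\<close> be the order of \<open>G\<close>. For \<open>a\<close> of degree \<open>g\<close> the power \<open>a\<^sup>n\<close> lies in \<open>R\<^sub>1\<close>, so \<open>a\<^sup>n e\<close> is a
  nonzero scalar times a unipotent element of \<open>e R\<^sub>1\<close>. In characteristic 0 unipotent elements have
  \<open>n\<close>-th roots (\<open>unipotent_inverse_root\<close>), and dividing \<open>a\<close> by such a root yields \<open>u\<^sub>g\<close> of degree \<open>g\<close>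
  whose \<open>n\<close>-th power is a nonzero multiple of \<open>e\<close>.

  This normalisation is stable under products: the words \<open>(g, h, g, h, \<dots>)\<close> and
  \<open>(g, \<dots>, g, h, \<dots>, h)\<close> with \<open>n\<close> occurrences of each letter both multiply to 1, so the commutation
  rule makes \<open>(u\<^sub>g u\<^sub>h)\<^sup>n\<close> a multiple of \<open>u\<^sub>g\<^sup>n u\<^sub>h\<^sup>n\<close> (\<open>power_order_mult\<close>). The element of
  \<open>e R\<^sub>1\<close> by which \<open>u\<^sub>g u\<^sub>h\<close> differs from \<open>u\<^sub>g\<^sub>h\<close> therefore has a scalar \<open>n\<close>-th power, and again by
  characteristic 0 it is itself a scalar (\<open>scalar_if_power_scalar\<close>). These scalars form the cocycle,
  and the \<open>u\<^sub>g\<close> span the twisted group algebra.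
\<close>

section \<open>Powers in rings, and lists\<close>

lemma eq_0_if_absorbs_nilpotent:
  fixes x :: "'a::ring_1"
  assumes "x = x * z" "z ^ m = 0"
  shows "x = 0"
proof -
  have "x = x * z ^ k" for k
  proof (induction k)
    case (Suc k)
    then show ?case
      using assms(1) by (simp flip: mult.assoc)
  qed simp
  then show ?thesis
    using assms(2) by (metis mult_zero_right)
qed

lemma power_mult_commuting:
  fixes x y :: "'a::monoid_mult"
  assumes "x * y = y * x"
  shows "(x * y) ^ n = x ^ n * y ^ n"
proof (induction n)
  case (Suc n)
  have "(x * y) ^ Suc n = x * (y * x ^ n) * y ^ n"
    by (simp add: Suc mult.assoc)
  also have "y * x ^ n = x ^ n * y"
    using assms by (metis power_commuting_commutes)
  finally show ?case
    by (simp add: mult.assoc)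
qed simp

lemma power_idempotent:
  fixes e :: "'a::monoid_mult"
  shows "n > 0 \<Longrightarrow> e * e = e \<Longrightarrow> e ^ n = e"
  by (induction n rule: nat_induct_non_zero) simp_all

lemma list_all2_concat_right:
  assumes "list_all2 P xs (concat yss)"
  obtains xss where "xs = concat xss" "list_all2 (list_all2 P) xss yss"
  using assms
proof (induction yss arbitrary: xs thesis)
  case Nil
  then show ?case by simp
next
  case (Cons ys yss)
  then obtain us vs where "xs = us @ vs" "list_all2 P us ys" "list_all2 P vs (concat yss)"
    by (auto simp: list_all2_append2)
  moreover from this(3) obtain xss where "vs = concat xss" "list_all2 (list_all2 P) xss yss"
    using Cons.IH by blast
  ultimately show ?case
    by (intro Cons.prems(1)[of "us # xss"]) auto
qed

section \<open>Evaluating polynomials in an algebra\<close>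

context K_algebra
begin

lemma power_scale: "(scale c x) ^ n = scale (c ^ n) (x ^ n)"
  by (induction n) (simp_all add: scale_mult_left scale_mult_right)

definition aeval :: "'k poly \<Rightarrow> 'r \<Rightarrow> 'r" where
  "aeval p a = fold_coeffs (\<lambda>c r. scale c 1 + a * r) p 0"

lemma aeval_0 [simp]: "aeval 0 a = 0"
  by (simp add: aeval_def)

lemma aeval_pCons [simp]: "aeval (pCons c p) a = scale c 1 + a * aeval p a"
  by (cases "p = 0 \<and> c = 0") (auto simp: aeval_def)

lemma aeval_smult [simp]: "aeval (Polynomial.smult c p) a = scale c (aeval p a)"
  by (induction p) (simp_all add: scale_right_distrib scale_mult_right)

lemma aeval_add [simp]: "aeval (p + q) a = aeval p a + aeval q a"
  by (induction p q rule: poly_induct2) (simp_all add: scale_left_distrib algebra_simps)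

lemma aeval_diff [simp]: "aeval (p - q) a = aeval p a - aeval q a"
  using aeval_add[of "p - q" q a] by (simp add: algebra_simps)

lemma aeval_sum: "aeval (\<Sum>i\<in>I. p i) a = (\<Sum>i\<in>I. aeval (p i) a)"
  by (induction I rule: infinite_finite_induct) simp_all

lemma aeval_monom [simp]: "aeval (Polynomial.monom c n) a = scale c (a ^ n)"
  by (induction n) (simp_all add: monom_0 monom_Suc scale_mult_right)

lemma aeval_linear_mult: "aeval ([:-c, 1:] * q) a = (a - scale c 1) * aeval q a"
  by (simp add: algebra_simps scale_mult_left)

text \<open>Split linear factors off the annihilating polynomial one by one. As \<open>v\<close> is nonzero, at some
  stage the remaining cofactor \<open>q\<close> no longer kills \<open>v\<close>, and then \<open>aeval q a * v\<close> is an eigenvector of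
  left multiplication by \<open>a\<close>.\<close>

lemma eigenvector_of_annihilator:
  fixes p :: "'k poly"
  assumes "\<And>q :: 'k poly. degree q > 0 \<Longrightarrow> \<exists>x. poly q x = 0"
    and "p \<noteq> 0" "aeval p a * v = 0" "v \<noteq> 0"
  obtains c q where "aeval q a * v \<noteq> 0" "(a - scale c 1) * (aeval q a * v) = 0"
  using assms(2,3)
proof (induction "degree p" arbitrary: p thesis rule: less_induct)
  case less
  show ?case
  proof (cases "degree p = 0")
    case True
    then obtain d where "p = [:d:]" "d \<noteq> 0"
      using less.prems(2) by (metis degree_eq_zeroE pCons_0_0)
    then show ?thesis
      using less.prems(3) assms(4) by (simp add: scale_mult_left)
  next
    case False
    then obtain c where "poly p c = 0"
      using assms(1) by auto
    then obtain q where p: "p = [:-c, 1:] * q"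
      by (metis dvdE poly_eq_0_iff_dvd)
    then have q: "q \<noteq> 0"
      using less.prems(2) by auto
    then have "degree q < degree p"
      unfolding p by (subst degree_mult_eq) auto
    moreover have "(a - scale c 1) * (aeval q a * v) = 0"
      using less.prems(3) unfolding p aeval_linear_mult by (simp add: mult.assoc)
    ultimately show ?thesis
      using less.hyps[of q] less.prems(1) q by blast
  qed
qed

end

section \<open>Finite-dimensional algebras\<close>

locale fd_K_algebra = K_algebra scale + finite_dimensional_vector_space scale Basis
  for scale :: "'k::field \<Rightarrow> 'r::ring_1 \<Rightarrow> 'r" and Basis
begin

text \<open>Either two powers of \<open>a\<close> coincide, or the first \<open>dimension + 1\<close> powers are distinct and
  therefore linearly dependent.\<close>

lemma annihilating_poly:
  obtains p where "p \<noteq> 0" "aeval p a = 0"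
proof (cases "inj (\<lambda>i::nat. a ^ i)")
  case False
  then obtain i j :: nat where ij: "i \<noteq> j" "a ^ i = a ^ j"
    by (auto simp: inj_def)
  have "Polynomial.monom (1::'k) i \<noteq> Polynomial.monom 1 j"
    using ij by (metis coeff_monom zero_neq_one)
  then show ?thesis
    using ij by (intro that[of "Polynomial.monom 1 i - Polynomial.monom 1 j"]) auto
next
  case True
  let ?S = "(\<lambda>i. a ^ i) ` {..dimension}"
  have inj: "inj_on (\<lambda>i. a ^ i) {..dimension}"
    using True by (auto simp: inj_on_def inj_def)
  then have "card ?S > dimension"
    by (simp add: card_image)
  then have "dependent ?S"
    using independent_card_le_dim[OF subset_UNIV, of ?S] dim_subset_UNIV[of UNIV] by force
  then obtain u v where u: "v \<in> ?S" "u v \<noteq> 0" "(\<Sum>v\<in>?S. scale (u v) v) = 0"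
    by (auto simp: dependent_finite)
  define p where "p = (\<Sum>i\<le>dimension. Polynomial.monom (u (a ^ i)) i)"
  obtain i where i: "i \<le> dimension" "v = a ^ i"
    using u by auto
  have "Polynomial.coeff p i = u (a ^ i)"
    using i by (simp add: p_def coeff_sum coeff_monom)
  then have "p \<noteq> 0"
    using i u by auto
  moreover have "aeval p a = 0"
    using u(3) by (simp add: p_def aeval_sum sum.reindex[OF inj] o_def)
  ultimately show ?thesis
    by (rule that)
qed

text \<open>Comparing the right ideals generated by \<open>x\<close> and by \<open>x * y\<close> through their dimensions turns
  finite dimension into a statement about single elements: a factor that does not lower the rank can
  be cancelled.\<close>

definition rank :: "'r \<Rightarrow> nat" where
  "rank x = dim (range ((*) x))"

lemma subspace_range_mult: "subspace (range ((*) x))"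
proof (rule subspaceI)
  show "0 \<in> range ((*) x)"
    by (metis mult_zero_right rangeI)
  show "y + z \<in> range ((*) x)" if "y \<in> range ((*) x)" "z \<in> range ((*) x)" for y z
    using that by (auto simp flip: distrib_left)
  show "scale c y \<in> range ((*) x)" if "y \<in> range ((*) x)" for c y
    using that by (auto simp flip: scale_mult_right)
qed

lemma factor_cancels_if_rank_mult_ge:
  assumes "rank x \<le> rank (x * y)"
  obtains z where "x = x * y * z"
proof -
  have "range ((*) (x * y)) = range ((*) x)"
    by (rule subspace_dim_equal[OF subspace_range_mult subspace_range_mult])
       (use assms in \<open>auto simp: mult.assoc rank_def\<close>)
  then have "x \<in> range ((*) (x * y))"
    by (metis mult.right_neutral rangeI)
  then show ?thesis
    using that by auto
qed

text \<open>Each factor strictly lowers the rank of the partial product, unless that product is already 0: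
  a factor \<open>b\<close> keeping the rank of \<open>x\<close> would give \<open>x = x * (b * z)\<close> with \<open>b * z\<close> nilpotent.\<close>

lemma prod_central_nilpotents_eq_0:
  fixes bs :: "'r list"
  assumes "\<And>b. b \<in> set bs \<Longrightarrow> \<exists>m. b ^ m = 0" "\<And>b y. b \<in> set bs \<Longrightarrow> b * y = y * b"
    and "length bs > dimension"
  shows "prod_list bs = 0"
proof -
  have "prod_list bs = 0 \<or> rank (prod_list bs) + length bs \<le> dimension"
    using assms(1,2)
  proof (induction bs)
    case Nil
    then show ?case
      using dim_subset_UNIV[of UNIV] by (simp add: rank_def del: dim_UNIV)
  next
    case (Cons b bs)
    let ?x = "prod_list bs"
    have comm: "b * ?x = ?x * b" "\<And>z. b * z = z * b"
      using Cons.prems(2) by auto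
    show ?case
    proof (cases "?x = 0 \<or> rank (?x * b) < rank ?x")
      case True
      then show ?thesis
        using Cons comm by fastforce
    next
      case False
      then obtain z where "?x = ?x * (b * z)"
        using factor_cancels_if_rank_mult_ge[of ?x b] by (metis mult.assoc not_less)
      moreover obtain m where "b ^ m = 0"
        using Cons.prems(1)[of b] by auto
      then have "(b * z) ^ m = 0"
        using comm(2) by (simp add: power_mult_commuting)
      ultimately have "?x = 0"
        by (rule eq_0_if_absorbs_nilpotent)
      with False show ?thesis
        by simp
    qed
  qed
  then show ?thesis
    using assms(3) by auto
qed

end

section \<open>Central subalgebras\<close>

text \<open>The degree-1 component of a graded regular algebra is the intended instance of \<open>C\<close>. Its
  elements commute with the whole algebra, which lets them be cancelled against homogeneous elements
  of any degree.\<close>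

locale central_subalgebra = fd_K_algebra scale Basis
  for scale :: "'k::field \<Rightarrow> 'r::ring_1 \<Rightarrow> 'r" and Basis +
  fixes C :: "'r set"
  assumes subspace_C: "subspace C"
    and one_C [simp]: "1 \<in> C"
    and mult_C [simp]: "\<lbrakk>x \<in> C; y \<in> C\<rbrakk> \<Longrightarrow> x * y \<in> C"
    and commute: "x \<in> C \<Longrightarrow> x * y = y * x"
begin

lemma add_C [simp]: "\<lbrakk>x \<in> C; y \<in> C\<rbrakk> \<Longrightarrow> x + y \<in> C"
  by (rule subspace_add[OF subspace_C])

lemma diff_C [simp]: "\<lbrakk>x \<in> C; y \<in> C\<rbrakk> \<Longrightarrow> x - y \<in> C"
  by (rule subspace_diff[OF subspace_C])

lemma scale_C [simp]: "x \<in> C \<Longrightarrow> scale c x \<in> C"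
  by (rule subspace_scale[OF subspace_C])

lemma power_C [simp]: "x \<in> C \<Longrightarrow> x ^ n \<in> C"
  by (induction n) simp_all

lemma aeval_C [simp]: "a \<in> C \<Longrightarrow> aeval p a \<in> C"
  by (induction p) (simp_all add: subspace_0[OF subspace_C])

lemma left_commute: "x \<in> C \<Longrightarrow> x * (y * z) = y * (x * z)"
  by (metis commute mult.assoc)

lemma power_mult_C: "x \<in> C \<Longrightarrow> (x * y) ^ n = x ^ n * y ^ n"
  by (intro power_mult_commuting commute)

text \<open>Fitting decomposition of multiplication by \<open>a\<close>: on the summand cut out by the idempotent \<open>f\<close>
  the element \<open>a\<close> is invertible, with inverse \<open>s\<close>; on the complementary summand it is nilpotent,
  since \<open>a ^ m * (1 - f) = 0\<close>. Solving an annihilating polynomial for its lowest nonzero term gives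
  \<open>a ^ k = a ^ Suc k * r\<close>, and then \<open>(a * r) ^ k\<close> is the required idempotent.\<close>

lemma fitting:
  assumes "a \<in> C"
  obtains f s m where "f \<in> C" "s \<in> C" "f * f = f" "a * s = f" "a ^ m * f = a ^ m"
proof -
  obtain p where p: "p \<noteq> 0" "aeval p a = 0"
    by (rule annihilating_poly)
  \<comment> \<open>The exponent \<open>j\<close> counts the vanishing low coefficients already stripped from the polynomial.\<close>
  have "\<exists>k. \<exists>r\<in>C. a ^ k = a ^ Suc k * r" if "p \<noteq> 0" "a ^ j * aeval p a = 0" for p j
    using that
  proof (induction p arbitrary: j)
    case (pCons c p)
    show ?case
    proof (cases "c = 0")
      case True
      then show ?thesis
        using pCons.IH[of "Suc j"] pCons.prems by (auto simp: power_Suc2 mult.assoc simp del: power_Suc)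
    next
      case False
      have "scale c (a ^ j) = - (a ^ j * (a * aeval p a))"
        using pCons.prems(2) by (simp add: distrib_left scale_mult_right eq_neg_iff_add_eq_0)
      then have "scale (1 / c) (scale c (a ^ j)) = scale (1 / c) (- (a ^ j * (a * aeval p a)))"
        by simp
      then have "a ^ j = a ^ Suc j * scale (- 1 / c) (aeval p a)"
        using False by (simp add: scale_mult_right power_Suc2 mult.assoc del: power_Suc)
      then show ?thesis
        using assms by (meson aeval_C scale_C)
    qed
  qed simp
  then obtain k r where r: "r \<in> C" "a ^ k = a ^ Suc k * r"
    using p by (metis mult_zero_right)
  have absorb: "a ^ k = a ^ k * (a * r) ^ i" for i
  proof (induction i)
    case (Suc i)
    have "a ^ k * (a * r) ^ Suc i = (a ^ Suc k * r) * (a * r) ^ i"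
      unfolding power_Suc[of "a * r"] power_Suc2[of a k] by (simp only: mult.assoc)
    then show ?case
      by (simp only: Suc[symmetric] r(2)[symmetric])
  qed simp
  define f where "f = (a * r) ^ k"
  have "f \<in> C"
    using assms r by (simp add: f_def)
  have af: "a ^ k * f = a ^ k"
    using absorb[of k] by (simp add: f_def)
  have f: "f = a ^ k * r ^ k"
    using assms by (simp add: f_def power_mult_C)
  have "f * f = (a ^ k * f) * r ^ k"
    using f \<open>f \<in> C\<close> by (metis commute mult.assoc)
  then have "f * f = f"
    by (simp add: af flip: f)
  moreover have "a * (a ^ k * r ^ Suc k) = f"
    using r(2) by (simp add: f power_commutes flip: mult.assoc)
  ultimately show ?thesis
    using that[of f "a ^ k * r ^ Suc k" k] assms r(1) \<open>f \<in> C\<close> af by simp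
qed

text \<open>Among the idempotents on which \<open>b\<close> stays non-nilpotent, take \<open>e\<close> of minimal rank. If
  \<open>e = e * f + e * (1 - f)\<close> is split by another idempotent, then \<open>b\<close> is non-nilpotent on one of the
  two parts, which by minimality is all of \<open>e\<close>. Applied to the Fitting idempotent of \<open>b\<close>, this makes
  \<open>b\<close> invertible on \<open>e\<close>. Applied to that of \<open>a - c\<close>, where \<open>c\<close> is an eigenvalue of \<open>a\<close> on \<open>e\<close>, it
  makes \<open>a - c\<close> nilpotent on \<open>e\<close>, because the eigenvector prevents it from being invertible.
  The hypothesis \<open>root\<close> says that the field is algebraically closed.\<close>

lemma ex_local_idempotent:
  assumes root: "\<And>q :: 'k poly. degree q > 0 \<Longrightarrow> \<exists>x. poly q x = 0"
    and b: "b \<in> C" "\<And>m. b ^ m \<noteq> 0"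
  obtains e d where "e \<in> C" "e * e = e" "e \<noteq> 0" "d \<in> C" "b * d = e"
    "\<And>a. a \<in> C \<Longrightarrow> a * e = a \<Longrightarrow> \<exists>c m. (a - scale c e) ^ m = 0"
proof -
  define Q where "Q e \<longleftrightarrow> e \<in> C \<and> e * e = e \<and> (\<forall>m. b ^ m * e \<noteq> 0)" for e
  have "Q 1"
    using b by (simp add: Q_def)
  then obtain e where "Q e" and le: "\<And>e'. Q e' \<Longrightarrow> rank e \<le> rank e'"
    using ex_has_least_nat[of Q 1 rank] by blast
  then have e: "e \<in> C" "e * e = e" and be: "b ^ m * e \<noteq> 0" for m
    by (auto simp: Q_def)
  have "e \<noteq> 0"
    using be[of 0] by simp
  have minimal: "e * f = e" if f: "f \<in> C" "f * f = f" "Q (e * f)" for f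
  proof -
    obtain z where "e = e * f * z"
      using factor_cancels_if_rank_mult_ge le[OF f(3)] by blast
    then show ?thesis
      using f by (metis mult.assoc commute)
  qed
  have split: "e * f = e \<or> e * f = 0" if f: "f \<in> C" "f * f = f" for f
  proof -
    have "Q (e * f) \<or> Q (e * (1 - f))"
    proof (rule ccontr)
      assume "\<not> ?thesis"
      moreover have "e * f * (e * f) = e * f"
        using e f by (metis mult.assoc commute)
      moreover have "(1 - f) * (1 - f) = 1 - f"
        using f by (simp add: algebra_simps)
      then have "e * (1 - f) * (e * (1 - f)) = e * (1 - f)"
        using e f by (metis mult.assoc commute)
      ultimately obtain m n where "b ^ m * (e * f) = 0" "b ^ n * (e * (1 - f)) = 0"
        using e f by (auto simp: Q_def)
      then have "b ^ (m + n) * (e * f) = 0" "b ^ (m + n) * (e * (1 - f)) = 0"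
        by (simp_all add: power_add mult.assoc left_commute[of "b ^ m"] b)
      then have "b ^ (m + n) * e = 0"
        by (simp add: algebra_simps)
      then show False
        using be by blast
    qed
    then show ?thesis
    proof
      assume "Q (e * (1 - f))"
      then have "e * (1 - f) = e"
        using f by (intro minimal) (auto simp: algebra_simps)
      then show ?thesis
        by (simp add: algebra_simps)
    qed (use minimal f in blast)
  qed
  obtain f s m where f: "f \<in> C" "s \<in> C" "f * f = f" "b * s = f" "b ^ m * f = b ^ m"
    using fitting[OF b(1)] .
  have "e * f \<noteq> 0"
    using be[of m] f e by (metis commute mult.assoc mult_zero_right)
  then have "e * f = e"
    using split f by blast
  then have "b * (s * e) = e"
    using f e by (metis commute mult.assoc)
  moreover have "\<exists>c m. (a - scale c e) ^ m = 0" if a: "a \<in> C" "a * e = a" for a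
  proof -
    obtain p where "p \<noteq> 0" "aeval p a * e = 0"
      using annihilating_poly by (metis mult_zero_left)
    then obtain c q where q: "aeval q a * e \<noteq> 0" "(a - scale c 1) * (aeval q a * e) = 0"
      using eigenvector_of_annihilator root \<open>e \<noteq> 0\<close> by metis
    define w where "w = aeval q a * e"
    define y where "y = a - scale c e"
    have "y \<in> C" and ye: "y * e = y"
      using a e by (auto simp: y_def algebra_simps scale_mult_left)
    then obtain f s m where f: "f \<in> C" "s \<in> C" "f * f = f" "y * s = f" "y ^ m * f = y ^ m"
      using fitting by blast
    have we: "w * e = w"
      by (simp add: w_def mult.assoc e)
    then have ew: "e * w = w"
      using e by (metis commute)
    have "y = (a - scale c 1) * e"
      using a by (simp add: y_def algebra_simps scale_mult_left)
    then have "y * w = 0"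
      using q(2) ew by (simp add: mult.assoc flip: w_def)
    then have "f * w = 0"
      using f \<open>y \<in> C\<close> by (metis commute mult.assoc mult_zero_right)
    then have "e * f \<noteq> e"
      using we e q(1) unfolding w_def[symmetric] by (metis commute mult.assoc mult_zero_right)
    then have "e * f = 0"
      using split f by blast
    then have "y ^ m * e = 0"
      using f e by (metis commute mult.assoc mult_zero_right)
    then have "y ^ Suc m = 0"
      using ye \<open>y \<in> C\<close> e by (metis commute mult.assoc mult_zero_right power_Suc)
    then show ?thesis
      unfolding y_def by blast
  qed
  ultimately show ?thesis
    using that[of e "s * e"] e f \<open>e \<noteq> 0\<close> by auto
qed

text \<open>The binomial formula modulo the square of \<open>x\<close>. Extracting roots of unipotent elements and
  showing that a scalar power comes from a scalar both rest on the linear term.\<close>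

lemma binomial_first_order:
  assumes "x \<in> C"
  obtains y where "y \<in> C"
    "(scale c 1 + x) ^ n = scale (c ^ n) 1 + scale (of_nat n * c ^ (n - 1)) x + x * x * y"
proof -
  have "\<exists>y\<in>C. (scale c 1 + x) ^ n = scale (c ^ n) 1 + scale (of_nat n * c ^ (n - 1)) x + x * x * y"
  proof (induction n)
    case 0
    then show ?case
      by (intro bexI[of _ 0]) (simp_all add: subspace_0[OF subspace_C])
  next
    case (Suc n)
    then obtain y where y: "y \<in> C"
      "(scale c 1 + x) ^ n = scale (c ^ n) 1 + scale (of_nat n * c ^ (n - 1)) x + x * x * y"
      by blast
    define d where "d = of_nat n * c ^ (n - 1)"
    have "c * d = of_nat n * c ^ n"
      by (cases n) (simp_all add: d_def)
    then have "(scale c 1 + x) ^ Suc n = scale (c ^ Suc n) 1 + scale (of_nat (Suc n) * c ^ n) x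
        + x * x * (scale d 1 + scale c y + x * y)"
      using y(1) assms unfolding power_Suc y(2)[folded d_def]
      by (simp add: mult.commute[of _ c] distrib_left distrib_right scale_mult_left scale_mult_right
          scale_left_distrib scale_right_distrib mult.assoc left_commute add_ac)
    then show ?case
      using y(1) assms
      by (intro bexI[of _ "scale d 1 + scale c y + x * y"]) (simp_all del: power_Suc)
  qed
  then show ?thesis
    using that by blast
qed

text \<open>Newton iteration for the equation \<open>s ^ n * (1 + x) = 1\<close>: the approximation \<open>1 - x / n\<close> solves
  it up to a multiple of \<open>x\<^sup>2\<close>, whose order of nilpotency is smaller than that of \<open>x\<close>.\<close>

lemma unipotent_inverse_root:
  assumes "(of_nat n :: 'k) \<noteq> 0" "x \<in> C" "x ^ m = 0"
  obtains s where "s \<in> C" "s ^ n * (1 + x) = 1"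
  using assms(2,3)
proof (induction m arbitrary: x thesis rule: less_induct)
  case (less m)
  consider "m = 0" | "m = 1" | "m \<ge> 2"
    by linarith
  then show ?case
  proof cases
    case 1
    with less.prems show ?thesis by simp
  next
    case 2
    with less.prems show ?thesis by (intro less.prems(1)[of 1]) auto
  next
    case 3
    define z where "z = scale (- 1 / of_nat n) x"
    have "z \<in> C"
      unfolding z_def by (rule scale_C) (rule less.prems)
    then obtain y where y: "y \<in> C"
      "(scale 1 1 + z) ^ n = scale (1 ^ n) 1 + scale (of_nat n * 1 ^ (n - 1)) z + z * z * y"
      by (rule binomial_first_order)
    define y' where "y' = scale (1 / of_nat n * (1 / of_nat n)) y * (1 + x) - 1"
    have zn: "(1 + z) ^ n = 1 - x + x * x * scale (1 / of_nat n * (1 / of_nat n)) y"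
      using y(2) assms(1) by (simp add: z_def scale_mult_left scale_mult_right)
    have step: "(1 + z) ^ n * (1 + x) = 1 + x * x * y'"
      unfolding zn by (simp add: y'_def algebra_simps)
    have "y' \<in> C"
      using y less.prems by (simp add: y'_def)
    have "(x * x * y') ^ (m - 1) = x ^ (2 * (m - 1)) * y' ^ (m - 1)"
      using less.prems by (simp add: power_mult_C power_mult power2_eq_square)
    also have "2 * (m - 1) = m + (m - 2)"
      using 3 by simp
    finally have "(x * x * y') ^ (m - 1) = 0"
      using less.prems by (simp add: power_add)
    then obtain s where s: "s \<in> C" "s ^ n * (1 + x * x * y') = 1"
      using less.IH[of "m - 1" "x * x * y'"] 3 \<open>y' \<in> C\<close> less.prems by auto
    have "(s * (1 + z)) ^ n * (1 + x) = 1"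
      using s step by (simp add: power_mult_C mult.assoc)
    then show ?thesis
      using less.prems(1)[of "s * (1 + z)"] s(1) \<open>z \<in> C\<close> by simp
  qed
qed

text \<open>Write \<open>a = c e + x\<close> with \<open>x\<close> nilpotent. Expanding \<open>a ^ n\<close> to first order shows that
  \<open>(r - c ^ n) e\<close> is nilpotent, hence 0. What remains is \<open>x (d + x y) = 0\<close> with
  \<open>d = n c ^ (n - 1)\<close>. Here \<open>d\<close> is nonzero, so that \<open>x\<close> is a multiple of \<open>x\<^sup>2\<close> and therefore 0.\<close>

lemma scalar_if_power_scalar:
  assumes n: "(of_nat n :: 'k) \<noteq> 0"
    and e: "e \<in> C" "e * e = e" "e \<noteq> 0"
    and a: "a \<in> C" "a * e = a" "(a - scale c e) ^ m = 0"
    and pow: "a ^ n = scale r e" "r \<noteq> 0"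
  shows "a = scale c e"
proof -
  have "n > 0"
    using n by (cases n) simp_all
  define x where "x = a - scale c e"
  have "x \<in> C" and xe: "x * e = x"
    using a e by (auto simp: x_def algebra_simps scale_mult_left)
  have xm: "x ^ m = 0"
    using a(3) by (simp add: x_def)
  have nil: "(x * y) ^ m = 0" for y
    using \<open>x \<in> C\<close> xm by (simp add: power_mult_C)
  obtain y where y: "y \<in> C"
    "(scale c 1 + x) ^ n = scale (c ^ n) 1 + scale (of_nat n * c ^ (n - 1)) x + x * x * y"
    using binomial_first_order \<open>x \<in> C\<close> by blast
  have "(scale c 1 + x) * e = a"
    using a xe by (simp add: x_def algebra_simps scale_mult_left)
  then have "(scale c 1 + x) ^ n * e = scale r e"
    using power_mult_C[of "scale c 1 + x" e n] \<open>x \<in> C\<close> e(2) pow(1) \<open>n > 0\<close>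
    by (simp add: power_idempotent)
  moreover have "x * x * y * e = x * (x * y)"
    using xe y(1) by (metis commute mult.assoc)
  ultimately have eq: "scale (r - c ^ n) e = x * (scale (of_nat n * c ^ (n - 1)) 1 + x * y)"
    using xe unfolding y(2)
    by (simp add: algebra_simps scale_mult_left scale_mult_right)
  have "r = c ^ n"
  proof (rule ccontr)
    assume "r \<noteq> c ^ n"
    then have "e = scale (1 / (r - c ^ n)) (scale (r - c ^ n) e)"
      by simp
    also have "\<dots> = e * (x * scale (1 / (r - c ^ n)) (scale (of_nat n * c ^ (n - 1)) 1 + x * y))"
      using xe \<open>x \<in> C\<close> by (subst eq) (metis commute mult.assoc scale_mult_right)
    finally show False
      using eq_0_if_absorbs_nilpotent[OF _ nil] e(3) by blast
  qed
  define d where "d = of_nat n * c ^ (n - 1)"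
  have "d \<noteq> 0"
    using \<open>r = c ^ n\<close> \<open>r \<noteq> 0\<close> \<open>n > 0\<close> n by (auto simp: d_def)
  have "scale d x = - (x * (x * y))"
    using eq \<open>r = c ^ n\<close> by (simp add: d_def distrib_left scale_mult_right eq_neg_iff_add_eq_0)
  then have "scale (1 / d) (scale d x) = scale (1 / d) (- (x * (x * y)))"
    by simp
  then have "x = x * (x * scale (- 1 / d) y)"
    using \<open>d \<noteq> 0\<close> by (simp add: scale_mult_right)
  then have "x = 0"
    by (rule eq_0_if_absorbs_nilpotent) (rule nil)
  then show ?thesis
    by (simp add: x_def)
qed

end

section \<open>Products of group elements\<close>

abbreviation (in monoid) list_mult :: "'a list \<Rightarrow> 'a" where
  "list_mult gs \<equiv> foldr (\<otimes>) gs \<one>"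

lemma (in monoid) list_mult_closed [simp]: "set gs \<subseteq> carrier G \<Longrightarrow> list_mult gs \<in> carrier G"
  by (induction gs) simp_all

lemma (in monoid) list_mult_append:
  "set gs \<subseteq> carrier G \<Longrightarrow> set hs \<subseteq> carrier G \<Longrightarrow> list_mult (gs @ hs) = list_mult gs \<otimes> list_mult hs"
  by (induction gs) (simp_all add: m_assoc)

lemma (in monoid) list_mult_replicate:
  "g \<in> carrier G \<Longrightarrow> list_mult (replicate n g) = g [^] n"
  by (induction n) (simp_all flip: nat_pow_Suc2)

lemma (in monoid) list_mult_concat_replicate:
  "set gs \<subseteq> carrier G \<Longrightarrow> list_mult (concat (replicate n gs)) = list_mult gs [^] n"
proof (induction n)
  case (Suc n)
  have "set (concat (replicate n gs)) \<subseteq> carrier G"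
    using Suc.prems by auto
  then show ?case
    using Suc by (simp add: list_mult_append del: foldr_append flip: nat_pow_Suc2)
qed simp

section \<open>Homogeneous components\<close>

locale fin_graded_algebra = graded_algebra G scale R
  for G :: "('g, 'm) monoid_scheme" (structure)
    and scale :: "'k::field \<Rightarrow> 'r::ring_1 \<Rightarrow> 'r" and R +
  assumes finite_carrier: "finite (carrier G)"
begin

lemma homogeneous_decomposition:
  obtains f where "\<And>g. g \<in> carrier G \<Longrightarrow> f g \<in> R g" "r = (\<Sum>g\<in>carrier G. f g)"
proof -
  obtain f where f: "\<forall>g\<in>carrier G. f g \<in> R g" "\<forall>g. g \<notin> carrier G \<longrightarrow> f g = 0"
    "(\<Sum>g | f g \<noteq> 0. f g) = r"
    using direct_sum[of r] by blast
  moreover have "(\<Sum>g | f g \<noteq> 0. f g) = (\<Sum>g\<in>carrier G. f g)"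
    by (rule sum.mono_neutral_left[OF finite_carrier]) (use f(2) in auto)
  ultimately show ?thesis
    by (intro that[of f]) auto
qed

lemma homogeneous_decomposition_unique:
  assumes "\<And>g. g \<in> carrier G \<Longrightarrow> f g \<in> R g" "\<And>g. g \<in> carrier G \<Longrightarrow> f' g \<in> R g"
    and "(\<Sum>g\<in>carrier G. f g) = (\<Sum>g\<in>carrier G. f' g)" and "g \<in> carrier G"
  shows "f g = f' g"
proof -
  define ext where "ext f g = (if g \<in> carrier G then f g else 0)" for f :: "'g \<Rightarrow> 'r" and g
  define D where "D f \<longleftrightarrow> (\<forall>g\<in>carrier G. f g \<in> R g) \<and> (\<forall>g. g \<notin> carrier G \<longrightarrow> f g = 0) \<and>
      finite {g. f g \<noteq> 0} \<and> (\<Sum>g | f g \<noteq> 0. f g) = (\<Sum>g\<in>carrier G. f' g)" for f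
  have "D (ext f0)" if "\<And>g. g \<in> carrier G \<Longrightarrow> f0 g \<in> R g"
      "(\<Sum>g\<in>carrier G. f0 g) = (\<Sum>g\<in>carrier G. f' g)" for f0
  proof -
    have "{g. ext f0 g \<noteq> 0} \<subseteq> carrier G"
      by (auto simp: ext_def)
    moreover from this have "(\<Sum>g | ext f0 g \<noteq> 0. ext f0 g) = (\<Sum>g\<in>carrier G. ext f0 g)"
      by (intro sum.mono_neutral_left[OF finite_carrier]) auto
    moreover have "(\<Sum>g\<in>carrier G. ext f0 g) = (\<Sum>g\<in>carrier G. f0 g)"
      by (simp add: ext_def)
    ultimately show ?thesis
      using that finite_subset[OF _ finite_carrier] unfolding D_def by (simp add: ext_def)
  qed
  then have "D (ext f)" "D (ext f')"
    using assms by auto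
  moreover have "\<exists>!f. D f"
    unfolding D_def by (rule direct_sum)
  ultimately have "ext f = ext f'"
    by blast
  then show ?thesis
    using assms(4) by (metis ext_def)
qed

text \<open>Let \<open>f \<one>\<close> be the degree-1 component of the unit. Comparing the components of degree \<open>h\<close> in
  \<open>x = x * 1\<close> for \<open>x\<close> of degree \<open>h\<close> shows \<open>x * f \<one> = x\<close>. So \<open>f \<one>\<close> acts as the unit on all homogeneous
  elements and must equal 1.\<close>

lemma one_homogeneous: "1 \<in> R \<one>"
proof -
  obtain f where f: "\<And>g. g \<in> carrier G \<Longrightarrow> f g \<in> R g" and one: "1 = (\<Sum>g\<in>carrier G. f g)"
    using homogeneous_decomposition by blast
  have hom: "x * f \<one> = x" if h: "h \<in> carrier G" "x \<in> R h" for h x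
  proof -
    define F where "F k = x * f (inv h \<otimes> k)" for k
    define F' where "F' k = (if k = h then x else 0)" for k
    have Fhom: "F k \<in> R k" if "k \<in> carrier G" for k
      using component_mult[of h "inv h \<otimes> k" x "f (inv h \<otimes> k)"] f h that
      by (simp add: F_def flip: G.m_assoc)
    have F'hom: "F' k \<in> R k" if "k \<in> carrier G" for k
      using h that subspace_0[OF subspace_component] by (simp add: F'_def)
    have "(\<Sum>k\<in>carrier G. F k) = (\<Sum>g\<in>carrier G. x * f g)"
      by (rule sum.reindex_bij_witness[of _ "\<lambda>g. h \<otimes> g" "\<lambda>k. inv h \<otimes> k"])
         (use h in \<open>auto simp: F_def simp flip: G.m_assoc\<close>)
    also have "\<dots> = x"
      by (simp flip: sum_distrib_left one)
    also have "\<dots> = (\<Sum>k\<in>carrier G. F' k)"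
      using h finite_carrier by (simp add: F'_def)
    finally have "F h = F' h"
      using homogeneous_decomposition_unique[of F F' h] Fhom F'hom h by blast
    then show ?thesis
      using h by (simp add: F_def F'_def)
  qed
  have "1 * f \<one> = 1"
  proof -
    have "1 * f \<one> = (\<Sum>g\<in>carrier G. f g * f \<one>)"
      unfolding one sum_distrib_right ..
    also have "\<dots> = 1"
      using hom f one by simp
    finally show ?thesis .
  qed
  then show ?thesis
    using f[of \<one>] by simp
qed

end

section \<open>Twisted bases\<close>

lemma twisted_carrier_finite:
  "finite (carrier G) \<Longrightarrow> f \<in> twisted_carrier G \<longleftrightarrow> (\<forall>g. g \<notin> carrier G \<longrightarrow> f g = 0)"
  by (auto simp: twisted_carrier_def intro: finite_subset)

text \<open>A homogeneous element of each degree, such that products agree with the element of the product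
  degree up to a nonzero scalar, is all that is needed to embed a twisted group algebra: associativity
  of \<open>R\<close> makes the scalars a cocycle, and homogeneity makes the elements linearly independent.\<close>

locale twisted_basis_family = fin_graded_algebra G scale R
  for G :: "('g, 'm) monoid_scheme" (structure)
    and scale :: "'k::field \<Rightarrow> 'r::ring_1 \<Rightarrow> 'r" and R +
  fixes u :: "'g \<Rightarrow> 'r" and \<alpha> :: "'g \<Rightarrow> 'g \<Rightarrow> 'k"
  assumes u_homogeneous: "g \<in> carrier G \<Longrightarrow> u g \<in> R g"
    and u_nonzero: "g \<in> carrier G \<Longrightarrow> u g \<noteq> 0"
    and u_mult: "\<lbrakk>g \<in> carrier G; h \<in> carrier G\<rbrakk> \<Longrightarrow> u g * u h = scale (\<alpha> g h) (u (g \<otimes> h))"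
    and \<alpha>_nonzero: "\<lbrakk>g \<in> carrier G; h \<in> carrier G\<rbrakk> \<Longrightarrow> \<alpha> g h \<noteq> 0"
begin

lemma cocycle_eq:
  assumes "g \<in> carrier G" "h \<in> carrier G" "k \<in> carrier G"
  shows "\<alpha> g h * \<alpha> (g \<otimes> h) k = \<alpha> g (h \<otimes> k) * \<alpha> h k"
proof -
  have "(u g * u h) * u k = u g * (u h * u k)"
    by (rule mult.assoc)
  then have "scale (\<alpha> g h * \<alpha> (g \<otimes> h) k) (u (g \<otimes> h \<otimes> k)) =
      scale (\<alpha> h k * \<alpha> g (h \<otimes> k)) (u (g \<otimes> h \<otimes> k))"
    using assms by (simp add: u_mult scale_mult_left scale_mult_right G.m_assoc)
  then show ?thesis
    using assms u_nonzero by (simp add: mult.commute)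
qed

lemma two_cocycle_\<alpha>: "two_cocycle G \<alpha>"
  by (simp add: two_cocycle_def cocycle_eq \<alpha>_nonzero)

text \<open>The cocycle need not be normalised. That its values at pairs involving \<open>\<one>\<close> are all equal
  makes \<open>u \<one>\<close>, divided by this common value, the unit of the embedded algebra.\<close>

lemma \<alpha>_one: "g \<in> carrier G \<Longrightarrow> \<alpha> \<one> g = \<alpha> \<one> \<one>" "g \<in> carrier G \<Longrightarrow> \<alpha> g \<one> = \<alpha> \<one> \<one>"
  using cocycle_eq[of \<one> \<one> g] cocycle_eq[of g \<one> \<one>] \<alpha>_nonzero[of \<one> g] \<alpha>_nonzero[of g \<one>]
  by auto

definition embed :: "('g \<Rightarrow> 'k) \<Rightarrow> 'r" where
  "embed f = (\<Sum>g\<in>carrier G. scale (f g) (u g))"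

lemma embed_add: "embed (\<lambda>g. f g + f' g) = embed f + embed f'"
  by (simp add: embed_def scale_left_distrib sum.distrib)

lemma embed_scale: "embed (\<lambda>g. c * f g) = scale c (embed f)"
  by (simp add: embed_def scale_sum_right)

lemma embed_mult:
  assumes "f \<in> twisted_carrier G" "f' \<in> twisted_carrier G"
  shows "embed (twisted_mult G \<alpha> f f') = embed f * embed f'"
proof -
  let ?P = "carrier G \<times> carrier G"
  let ?m = "\<lambda>(g, h). g \<otimes> h" and ?t = "\<lambda>(g, h). f g * f' h * \<alpha> g h"
  have finP: "finite ?P"
    using finite_carrier by simp
  have "twisted_mult G \<alpha> f f' k = (\<Sum>p | p \<in> ?P \<and> ?m p = k. ?t p)" for k
    unfolding twisted_mult_def
    by (rule sum.mono_neutral_left)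
       (use assms finP in \<open>auto simp: twisted_carrier_finite[OF finite_carrier]\<close>)
  then have "embed (twisted_mult G \<alpha> f f') =
      (\<Sum>k\<in>carrier G. \<Sum>p | p \<in> ?P \<and> ?m p = k. scale (?t p) (u (?m p)))"
    unfolding embed_def by (simp add: scale_sum_left)
  also have "\<dots> = (\<Sum>p\<in>?P. scale (?t p) (u (?m p)))"
    by (rule sum.group[OF finP finite_carrier]) auto
  also have "\<dots> = (\<Sum>(g, h)\<in>?P. scale (f g) (u g) * scale (f' h) (u h))"
    by (intro sum.cong) (auto simp: u_mult scale_mult_left scale_mult_right mult_ac)
  also have "\<dots> = embed f * embed f'"
    by (simp add: embed_def sum_product sum.cartesian_product)
  finally show ?thesis .
qed

lemma inj_on_embed: "inj_on embed (twisted_carrier G)"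
proof (rule inj_onI)
  fix f f' assume f: "f \<in> twisted_carrier G" "f' \<in> twisted_carrier G" "embed f = embed f'"
  have "f g = f' g" for g
  proof (cases "g \<in> carrier G")
    case True
    have "scale (f g) (u g) = scale (f' g) (u g)"
      by (rule homogeneous_decomposition_unique[of "\<lambda>g. scale (f g) (u g)" "\<lambda>g. scale (f' g) (u g)"])
        (use f True in \<open>auto simp: embed_def intro: subspace_scale subspace_component u_homogeneous\<close>)
    then show ?thesis
      using u_nonzero[OF True] by simp
  qed (use f in \<open>simp add: twisted_carrier_finite[OF finite_carrier]\<close>)
  then show "f = f'" ..
qed

lemma twisted_carrier_closed:
  assumes "f \<in> twisted_carrier G" "f' \<in> twisted_carrier G"
  shows "(\<lambda>g. f g + f' g) \<in> twisted_carrier G" "(\<lambda>g. c * f g) \<in> twisted_carrier G"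
    and "twisted_mult G \<alpha> f f' \<in> twisted_carrier G"
proof -
  have "twisted_mult G \<alpha> f f' k = 0" if "k \<notin> carrier G" for k
    unfolding twisted_mult_def
  proof (rule sum.neutral, safe)
    fix g h assume "f g \<noteq> 0" "f' h \<noteq> 0" "k = g \<otimes> h"
    then show "f g * f' h * \<alpha> g h = 0"
      using assms that unfolding twisted_carrier_finite[OF finite_carrier] by (metis G.m_closed)
  qed
  then show "twisted_mult G \<alpha> f f' \<in> twisted_carrier G"
    by (simp add: twisted_carrier_finite[OF finite_carrier])
qed (use assms in \<open>simp_all add: twisted_carrier_finite[OF finite_carrier]\<close>)

lemma twisted_group_algebra_iso_embed:
  "twisted_group_algebra_iso G \<alpha> (embed ` twisted_carrier G) embed"
  by (simp add: twisted_group_algebra_iso_def bij_betw_def inj_on_embed embed_add embed_scale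
      embed_mult)

lemma subalgebra_embed: "subalgebra (embed ` twisted_carrier G)"
proof -
  let ?T = "twisted_carrier G"
  define e where "e = scale (1 / \<alpha> \<one> \<one>) (u \<one>)"
  have "(\<lambda>_. 0) \<in> ?T" "embed (\<lambda>_. 0) = 0"
    by (simp_all add: twisted_carrier_def embed_def)
  then have zero: "0 \<in> embed ` ?T"
    by (metis imageI)
  have sub: "subspace (embed ` ?T)"
  proof (rule subspaceI)
    show "x + y \<in> embed ` ?T" if "x \<in> embed ` ?T" "y \<in> embed ` ?T" for x y
      using that by (auto simp: twisted_carrier_closed simp flip: embed_add)
    show "scale c x \<in> embed ` ?T" if "x \<in> embed ` ?T" for c x
      using that by (auto simp: twisted_carrier_closed simp flip: embed_scale)
  qed (rule zero)
  have mult: "\<forall>x\<in>embed ` ?T. \<forall>y\<in>embed ` ?T. x * y \<in> embed ` ?T"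
    by (auto simp: twisted_carrier_closed simp flip: embed_mult)
  have "embed (\<lambda>g. 1 / \<alpha> \<one> \<one> * twisted_basis \<one> g) = e"
    unfolding embed_scale e_def using finite_carrier
    by (simp add: embed_def twisted_basis_def if_distrib[of "\<lambda>c. scale c _"] cong: if_cong)
  moreover have "(\<lambda>g. 1 / \<alpha> \<one> \<one> * twisted_basis \<one> g) \<in> ?T"
    by (simp add: twisted_carrier_finite[OF finite_carrier] twisted_basis_def)
  ultimately have e_in: "e \<in> embed ` ?T"
    by (metis imageI)
  have "e * u g = u g \<and> u g * e = u g" if "g \<in> carrier G" for g
    using that \<alpha>_nonzero[of \<one> \<one>]
    by (simp add: e_def u_mult scale_mult_left scale_mult_right \<alpha>_one(1)[OF that] \<alpha>_one(2)[OF that])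
  then have "e * embed f = embed f \<and> embed f * e = embed f" for f
    by (simp add: embed_def sum_distrib_left sum_distrib_right scale_mult_left scale_mult_right)
  with sub mult e_in show ?thesis
    unfolding subalgebra_def by blast
qed

end

section \<open>Homogeneous elements of a graded regular algebra\<close>

locale fd_graded_regular_algebra = graded_regular_algebra G scale R \<theta> + fd_K_algebra scale Basis
  for G :: "('g, 'm) monoid_scheme" (structure)
    and scale :: "'k::{alg_closed_field, field_char_0} \<Rightarrow> 'r::ring_1 \<Rightarrow> 'r"
    and R \<theta> Basis +
  assumes finite_carrier: "finite (carrier G)"
begin

sublocale fin_graded_algebra G scale R
  by unfold_locales (rule finite_carrier)

lemma prod_list_homogeneous:
  "list_all2 (\<lambda>a g. a \<in> R g) as gs \<Longrightarrow> set gs \<subseteq> carrier G \<Longrightarrow> prod_list as \<in> R (G.list_mult gs)"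
  by (induction rule: list_all2_induct) (simp_all add: one_homogeneous component_mult)

lemma power_homogeneous:
  assumes "g \<in> carrier G" "a \<in> R g"
  shows "a ^ n \<in> R (g [^] n)"
proof (induction n)
  case (Suc n)
  then show ?case
    using component_mult[OF _ _ Suc assms(2)] assms(1) by (simp add: power_Suc2 del: power_Suc)
qed (simp add: one_homogeneous)

lemma power_order_homogeneous:
  "g \<in> carrier G \<Longrightarrow> a \<in> R g \<Longrightarrow> a ^ order G \<in> R \<one>"
  using power_homogeneous[of g a "order G"] by (simp add: G.pow_order_eq_1)

lemma order_pos: "order G > 0"
  using finite_carrier G.order_gt_0_iff_finite by blast

text \<open>The commutation rule for words of length 2. What matters is that \<open>t\<close> depends on the
  degrees only.\<close>

lemma swap_homogeneous:
  assumes "g \<in> carrier G" "h \<in> carrier G" "g \<otimes> h = h \<otimes> g"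
  obtains t where "t \<noteq> 0" "\<And>a b. a \<in> R g \<Longrightarrow> b \<in> R h \<Longrightarrow> a * b = scale t (b * a)"
proof -
  let ?\<sigma> = "Transposition.transpose 0 (1::nat)"
  have "?\<sigma> permutes {..<length [g, h]}"
    by (intro permutes_swap_id) auto
  then have \<sigma>: "?\<sigma> \<in> prod_perms G [g, h]"
    using assms by (simp add: prod_perms_def permute_list_def upt_rec)
  have "a * b = scale (\<theta> [g, h] ?\<sigma>) (b * a)" if "a \<in> R g" "b \<in> R h" for a b
    using commutation[of "[g, h]" ?\<sigma> "[a, b]"] \<sigma> assms that
    by (simp add: permute_list_def upt_rec)
  then show ?thesis
    using that commutation_nonzero[of "[g, h]" ?\<sigma>] \<sigma> assms by auto
qed

text \<open>The scalar by which elements of degrees \<open>\<one>\<close> and \<open>g\<close> commute can be read off from the product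
  with the unit, which is homogeneous of degree \<open>\<one>\<close>; so it is 1.\<close>

lemma component_one_central:
  assumes "x \<in> R \<one>"
  shows "x * y = y * x"
proof -
  obtain f where f: "\<And>g. g \<in> carrier G \<Longrightarrow> f g \<in> R g" "y = (\<Sum>g\<in>carrier G. f g)"
    using homogeneous_decomposition by blast
  have "x * f g = f g * x" if g: "g \<in> carrier G" for g
  proof (cases "f g = 0")
    case False
    obtain t where t: "\<And>a b. a \<in> R \<one> \<Longrightarrow> b \<in> R g \<Longrightarrow> a * b = scale t (b * a)"
      by (rule swap_homogeneous[of \<one> g]) (use g in auto)
    have "scale 1 (f g) = scale t (f g)"
      using t[OF one_homogeneous f(1)[OF g]] by simp
    then have "t = 1"
      using False by (metis scale_cancel_right)
    then show ?thesis
      using t[OF assms f(1)[OF g]] by simp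
  qed simp
  then show ?thesis
    by (simp add: f(2) sum_distrib_left sum_distrib_right)
qed

sublocale central_subalgebra scale Basis "R \<one>"
  using component_mult[of \<one> \<one>]
  by unfold_locales (auto simp: subspace_component one_homogeneous intro: component_one_central)

text \<open>The commutation rule with the permutation left implicit. Elements are paired with their degrees
  so that one permutation rearranges both.\<close>

lemma rearrange_homogeneous:
  assumes "mset zs = mset zs'" "\<And>a g. (a, g) \<in> set zs \<Longrightarrow> g \<in> carrier G \<and> a \<in> R g"
    and "G.list_mult (map snd zs) = G.list_mult (map snd zs')"
  obtains t where "t \<noteq> 0" "prod_list (map fst zs) = scale t (prod_list (map fst zs'))"
proof -
  obtain \<sigma> where \<sigma>: "\<sigma> permutes {..<length zs}" "permute_list \<sigma> zs = zs'"
    using mset_eq_permutation[OF assms(1)[symmetric]] by blast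
  have zs: "set (map snd zs) \<subseteq> carrier G"
    "list_all2 (\<lambda>a g. a \<in> R g) (map fst zs) (map snd zs)"
    using assms(2) by (auto simp: list_all2_conv_all_nth)
  have "\<sigma> \<in> prod_perms G (map snd zs)"
    using \<sigma> assms(3) by (simp add: prod_perms_def permute_list_map)
  then show ?thesis
    using that[of "\<theta> (map snd zs) \<sigma>"] commutation commutation_nonzero zs \<sigma>
    by (simp add: permute_list_map)
qed

text \<open>By Lagrange's theorem the words \<open>(g, h, g, h, \<dots>)\<close> and \<open>(g, \<dots>, g, h, \<dots>, h)\<close> have the same
  product \<open>\<one>\<close> when each letter occurs \<open>order G\<close> times, so the commutation rule applies to them even
  if \<open>g\<close> and \<open>h\<close> do not commute.\<close>

lemma power_order_mult:
  assumes "g \<in> carrier G" "h \<in> carrier G" "a \<in> R g" "b \<in> R h"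
  obtains t where "t \<noteq> 0" "(a * b) ^ order G = scale t (a ^ order G * b ^ order G)"
proof -
  let ?n = "order G"
  let ?zs = "concat (replicate ?n [(a, g), (b, h)])"
  let ?zs' = "replicate ?n (a, g) @ replicate ?n (b, h)"
  have mset: "mset (concat (replicate n [x, y])) = mset (replicate n x @ replicate n y)"
    for n :: nat and x y :: "'r \<times> 'g"
    by (induction n) auto
  have prod: "prod_list (concat (replicate n xs)) = prod_list xs ^ n" for n and xs :: "'r list"
    by (induction n) simp_all
  have map: "map f (concat (replicate n [x, y])) = concat (replicate n [f x, f y])"
    for f :: "'r \<times> 'g \<Rightarrow> 'x" and n x y
    by (induction n) simp_all
  have "G.list_mult (map snd ?zs) = (g \<otimes> h) [^] ?n"
    using assms G.list_mult_concat_replicate[of "[g, h]" ?n] unfolding map by simp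
  moreover have "set (replicate ?n g) \<subseteq> carrier G" "set (replicate ?n h) \<subseteq> carrier G"
    using assms by auto
  then have "G.list_mult (map snd ?zs') = g [^] ?n \<otimes> h [^] ?n"
    using assms G.list_mult_append[of "replicate ?n g" "replicate ?n h"]
    by (simp add: G.list_mult_replicate del: foldr_append foldr_replicate)
  ultimately have "G.list_mult (map snd ?zs) = G.list_mult (map snd ?zs')"
    using assms by (simp add: G.pow_order_eq_1 del: foldr_append foldr_replicate)
  moreover have "\<And>x k. (x, k) \<in> set ?zs \<Longrightarrow> k \<in> carrier G \<and> x \<in> R k"
    using assms by (auto split: if_splits)
  ultimately obtain t where "t \<noteq> 0" "prod_list (map fst ?zs) = scale t (prod_list (map fst ?zs'))"
    using rearrange_homogeneous[of ?zs ?zs'] mset[of ?n "(a, g)" "(b, h)"] by metis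
  then show ?thesis
    using that unfolding map by (simp add: prod)
qed

text \<open>Let \<open>L\<close> be a word with product \<open>\<one>\<close> in which all group elements occur. Regularity gives a nonzero
  product along \<open>dimension + 1\<close> copies of \<open>L\<close>, which is a product of as many elements of the central
  component \<open>R \<one>\<close>, so one of these blocks is not nilpotent. A factor \<open>a\<close> of degree \<open>g\<close> can be moved
  to the front of its block, up to a scalar: in \<open>p * (a * q)\<close> the degrees of \<open>p\<close> and \<open>a * q\<close> are mutually inverse and
  hence commute.\<close>

lemma ex_nonnilpotent_with_homogeneous_factors:
  obtains b where "b \<in> R \<one>" "\<And>m. b ^ m \<noteq> 0"
    "\<And>g. g \<in> carrier G \<Longrightarrow> \<exists>h\<in>carrier G. \<exists>a\<in>R g. \<exists>w\<in>R h. \<exists>t. t \<noteq> 0 \<and> a * w = scale t b"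
proof -
  obtain xs where xs: "set xs = carrier G"
    using finite_carrier finite_list by blast
  define L where "L = concat (map (\<lambda>g. [g, inv g]) xs)"
  have L: "set L = carrier G"
    using xs by (auto simp: L_def)
  have "set ys \<subseteq> carrier G \<Longrightarrow> G.list_mult (concat (map (\<lambda>g. [g, inv g]) ys)) = \<one>" for ys
    by (induction ys) (auto simp flip: G.m_assoc)
  then have L1: "G.list_mult L = \<one>"
    using xs by (simp add: L_def)
  define N where "N = Suc dimension"
  have "set (concat (replicate N L)) \<subseteq> carrier G"
    using L by auto
  then obtain as where as: "list_all2 (\<lambda>a g. a \<in> R g) as (concat (replicate N L))" "prod_list as \<noteq> 0"
    using ex_nonzero_product by blast
  then obtain bss where bss: "as = concat bss"
      "list_all2 (list_all2 (\<lambda>a g. a \<in> R g)) bss (replicate N L)"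
    using list_all2_concat_right by blast
  have block: "list_all2 (\<lambda>a g. a \<in> R g) bs L" if "bs \<in> set bss" for bs
    using bss(2) that by (auto simp: list_all2_conv_all_nth in_set_conv_nth)
  then have block1: "prod_list bs \<in> R \<one>" if "bs \<in> set bss" for bs
    using prod_list_homogeneous[OF block[OF that]] L L1 by simp
  have "prod_list (map prod_list bss) = prod_list as"
    unfolding bss(1) by (induction bss) simp_all
  moreover have "length bss = N"
    using list_all2_lengthD[OF bss(2)] by simp
  ultimately have "\<exists>bs\<in>set bss. \<forall>m. prod_list bs ^ m \<noteq> 0"
    using prod_central_nilpotents_eq_0[of "map prod_list bss"] as(2) block1 component_one_central
    by (force simp: N_def)
  then obtain bs where bs: "bs \<in> set bss" "\<And>m. prod_list bs ^ m \<noteq> 0"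
    by blast
  show ?thesis
  proof (rule that[OF block1[OF bs(1)] bs(2)])
    fix g assume g: "g \<in> carrier G"
    then obtain L\<^sub>1 L\<^sub>2 where L12: "L = L\<^sub>1 @ g # L\<^sub>2"
      using L by (metis split_list)
    then obtain xs\<^sub>1 a xs\<^sub>2 where split: "bs = xs\<^sub>1 @ a # xs\<^sub>2" "a \<in> R g"
        "list_all2 (\<lambda>a g. a \<in> R g) xs\<^sub>1 L\<^sub>1" "list_all2 (\<lambda>a g. a \<in> R g) xs\<^sub>2 L\<^sub>2"
      using block[OF bs(1)] by (auto simp: list_all2_append2 list_all2_Cons2)
    have sub: "set L\<^sub>1 \<subseteq> carrier G" "set L\<^sub>2 \<subseteq> carrier G"
      using L L12 by auto
    let ?h\<^sub>1 = "G.list_mult L\<^sub>1" and ?h\<^sub>2 = "G.list_mult L\<^sub>2"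
    let ?p = "prod_list xs\<^sub>1" and ?q = "prod_list xs\<^sub>2"
    have h: "?h\<^sub>1 \<in> carrier G" "?h\<^sub>2 \<in> carrier G" "?p \<in> R ?h\<^sub>1" "?q \<in> R ?h\<^sub>2"
      using sub split by (auto intro: prod_list_homogeneous)
    have "?h\<^sub>1 \<otimes> (g \<otimes> ?h\<^sub>2) = \<one>"
      using L1 G.list_mult_append[of L\<^sub>1 "g # L\<^sub>2"] sub g unfolding L12 by simp
    then have comm: "?h\<^sub>1 \<otimes> (g \<otimes> ?h\<^sub>2) = (g \<otimes> ?h\<^sub>2) \<otimes> ?h\<^sub>1"
      using G.inv_comm[of ?h\<^sub>1 "g \<otimes> ?h\<^sub>2"] h g by simp
    obtain t where "t \<noteq> 0" and t: "\<And>x y. x \<in> R ?h\<^sub>1 \<Longrightarrow> y \<in> R (g \<otimes> ?h\<^sub>2) \<Longrightarrow> x * y = scale t (y * x)"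
      using swap_homogeneous[OF _ _ comm] h g by auto
    have "prod_list bs = ?p * (a * ?q)"
      using split by (simp add: mult.assoc)
    also have "\<dots> = scale t ((a * ?q) * ?p)"
      using t h g split component_mult by auto
    finally have "a * (?q * ?p) = scale (1 / t) (prod_list bs)"
      using \<open>t \<noteq> 0\<close> by (simp add: mult.assoc)
    moreover have "?q * ?p \<in> R (?h\<^sub>2 \<otimes> ?h\<^sub>1)"
      using h by (intro component_mult)
    ultimately show "\<exists>h\<in>carrier G. \<exists>a\<in>R g. \<exists>w\<in>R h. \<exists>t. t \<noteq> 0 \<and> a * w = scale t (prod_list bs)"
      using h split(2) \<open>t \<noteq> 0\<close> by (metis G.m_closed divide_eq_0_iff zero_neq_one)
  qed
qed

text \<open>Start from a factor \<open>a\<close> of \<open>b\<close> in degree \<open>g\<close>. Since \<open>b\<close> is invertible on the local idempotent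
  \<open>e\<close>, so is \<open>a ^ order G\<close>, which is therefore a nonzero scalar times a unipotent element there.
  Dividing \<open>a\<close> by a root of the unipotent part leaves the scalar.\<close>

lemma ex_scalar_power_units:
  obtains e u l where "e \<in> R \<one>" "e * e = e" "e \<noteq> 0"
    "\<And>a. a \<in> R \<one> \<Longrightarrow> a * e = a \<Longrightarrow> \<exists>c m. (a - scale c e) ^ m = 0"
    "\<And>g. g \<in> carrier G \<Longrightarrow> u g \<in> R g \<and> u g * e = u g \<and> l g \<noteq> 0 \<and> u g ^ order G = scale (l g) e"
proof -
  let ?n = "order G"
  obtain b where b: "b \<in> R \<one>" "\<And>m. b ^ m \<noteq> 0" and factor:
    "\<And>g. g \<in> carrier G \<Longrightarrow> \<exists>h\<in>carrier G. \<exists>a\<in>R g. \<exists>w\<in>R h. \<exists>t. t \<noteq> 0 \<and> a * w = scale t b"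
    using ex_nonnilpotent_with_homogeneous_factors by blast
  obtain e d where e: "e \<in> R \<one>" "e * e = e" "e \<noteq> 0" and d: "d \<in> R \<one>" "b * d = e"
    and loc: "\<And>a. a \<in> R \<one> \<Longrightarrow> a * e = a \<Longrightarrow> \<exists>c m. (a - scale c e) ^ m = 0"
    using ex_local_idempotent[OF alg_closed_imp_poly_has_root b] by blast
  have "\<exists>u l. u \<in> R g \<and> u * e = u \<and> l \<noteq> 0 \<and> u ^ ?n = scale l e" if g: "g \<in> carrier G" for g
  proof -
    obtain h a w t where a: "h \<in> carrier G" "a \<in> R g" "w \<in> R h" "t \<noteq> 0" "a * w = scale t b"
      using factor[OF g] by blast
    obtain t' where t': "t' \<noteq> 0" "(a * w) ^ ?n = scale t' (a ^ ?n * w ^ ?n)"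
      using power_order_mult[OF g a(1-3)] .
    define y where "y = a ^ ?n * e"
    have an: "a ^ ?n \<in> R \<one>"
      using power_order_homogeneous[OF g a(2)] .
    then have y: "y \<in> R \<one>" "y * e = y"
      using e by (simp_all add: y_def mult.assoc)
    obtain c m where cm: "(y - scale c e) ^ m = 0"
      using loc[OF y] by blast
    have "scale (1 / t') (scale t' (a ^ ?n * w ^ ?n)) = scale (1 / t') (scale (t ^ ?n) (b ^ ?n))"
      using t'(2) a(5) by (simp add: power_scale)
    then have anwn: "a ^ ?n * w ^ ?n = scale (t ^ ?n / t') (b ^ ?n)"
      using t'(1) by simp
    \<comment> \<open>\<open>y\<close> is invertible on \<open>e\<close>, because \<open>a ^ ?n * w ^ ?n\<close> is a multiple of \<open>b ^ ?n\<close>.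
      Consequently \<open>y\<close> is not nilpotent, that is, \<open>c\<close> is nonzero.\<close>
    have "y * (w ^ ?n * d ^ ?n) = e * (a ^ ?n * w ^ ?n) * d ^ ?n"
      unfolding y_def using e(1) by (metis commute mult.assoc)
    also have "a ^ ?n * w ^ ?n = scale (t ^ ?n / t') (b ^ ?n)"
      by (rule anwn)
    also have "e * scale (t ^ ?n / t') (b ^ ?n) * d ^ ?n = scale (t ^ ?n / t') (e * (b * d) ^ ?n)"
      using b(1) by (simp add: scale_mult_left scale_mult_right power_mult_C mult.assoc)
    also have "e * (b * d) ^ ?n = e"
      using d e order_pos by (simp add: power_idempotent)
    finally have "e = e * (y * (scale (t' / t ^ ?n) (w ^ ?n * d ^ ?n)))"
      using a t' e by (simp add: scale_mult_right)
    moreover have "(y * v) ^ m = 0" if "c = 0" for v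
      using cm y(1) that by (simp add: power_mult_C)
    ultimately have "c \<noteq> 0"
      using e(3) eq_0_if_absorbs_nilpotent by blast
    define z where "z = scale (1 / c) (y - scale c e)"
    have z: "z \<in> R \<one>" "z * e = z"
      using y e by (simp_all add: z_def scale_mult_left algebra_simps)
    moreover have "z ^ m = 0"
      unfolding z_def power_scale cm by simp
    ultimately obtain s where s: "s \<in> R \<one>" "s ^ ?n * (1 + z) = 1"
      using unipotent_inverse_root[of ?n z m] order_pos by auto
    have "scale c ((1 + z) * e) = y"
      using \<open>c \<noteq> 0\<close> z by (simp add: z_def algebra_simps scale_mult_left)
    have "(s * (e * a)) ^ ?n = s ^ ?n * (e ^ ?n * a ^ ?n)"
      using s e by (simp add: power_mult_C)
    also have "\<dots> = s ^ ?n * y"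
      using e an order_pos by (simp add: power_idempotent y_def commute)
    also have "\<dots> = scale c (s ^ ?n * (1 + z) * e)"
      by (simp add: scale_mult_right mult.assoc flip: \<open>scale c ((1 + z) * e) = y\<close>)
    finally have "(s * (e * a)) ^ ?n = scale c e"
      using s by simp
    moreover have "s * (e * a) \<in> R g"
      using component_mult[of \<one> g s "e * a"] component_mult[of \<one> g e a] s e a g by simp
    moreover have "s * (e * a) * e = s * (e * a)"
      using e by (metis commute mult.assoc)
    ultimately show ?thesis
      using \<open>c \<noteq> 0\<close> by blast
  qed
  then obtain u l where "\<And>g. g \<in> carrier G \<Longrightarrow>
      u g \<in> R g \<and> u g * e = u g \<and> l g \<noteq> 0 \<and> u g ^ ?n = scale (l g) e"
    by metis
  then show ?thesis
    using that e loc by blast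
qed

text \<open>The quotient \<open>a\<close> of \<open>u g * u h\<close> by \<open>u (g \<otimes> h)\<close> lies in \<open>R \<one>\<close>. The powers of \<open>u g * u h\<close> and
  \<open>u (g \<otimes> h)\<close> with exponent \<open>order G\<close> are nonzero scalar multiples of \<open>e\<close>, hence so is that of \<open>a\<close>,
  and this forces \<open>a\<close> itself to be a scalar multiple of \<open>e\<close>.\<close>

lemma ex_twisted_basis_family:
  obtains u \<alpha> where "twisted_basis_family G scale R u \<alpha>"
proof -
  let ?n = "order G"
  obtain e u l where e: "e \<in> R \<one>" "e * e = e" "e \<noteq> 0"
    and loc: "\<And>a. a \<in> R \<one> \<Longrightarrow> a * e = a \<Longrightarrow> \<exists>c m. (a - scale c e) ^ m = 0"
    and "\<And>g. g \<in> carrier G \<Longrightarrow>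
      u g \<in> R g \<and> u g * e = u g \<and> l g \<noteq> 0 \<and> u g ^ ?n = scale (l g) e"
    using ex_scalar_power_units by blast
  then have u: "u g \<in> R g" "u g * e = u g" "l g \<noteq> 0" "u g ^ ?n = scale (l g) e"
    if "g \<in> carrier G" for g
    using that by auto
  have "\<exists>c. c \<noteq> 0 \<and> u g * u h = scale c (u (g \<otimes> h))"
    if g: "g \<in> carrier G" and h: "h \<in> carrier G" for g h
  proof -
    let ?k = "g \<otimes> h"
    have k: "?k \<in> carrier G"
      using g h by simp
    \<comment> \<open>As a power of \<open>u ?k\<close> is a multiple of \<open>e\<close>, a multiple of the preceding power inverts \<open>u ?k\<close> on \<open>e\<close>.\<close>
    define v where "v = scale (1 / l ?k) (u ?k ^ (?n - 1))"
    have vu: "v * u ?k = e"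
      using u(3,4)[OF k] order_pos by (simp add: v_def scale_mult_left flip: power_Suc2)
    define a where "a = u g * u h * v"
    have "v \<in> R (?k [^] (?n - 1))"
      unfolding v_def using power_homogeneous[OF k u(1)[OF k]] subspace_component k
      by (auto intro: subspace_scale)
    then have "a \<in> R (?k \<otimes> ?k [^] (?n - 1))"
      unfolding a_def using g h u by (intro component_mult) auto
    also have "?k \<otimes> ?k [^] (?n - 1) = \<one>"
      using G.nat_pow_Suc2[OF k, of "?n - 1"] order_pos G.pow_order_eq_1[OF k] by simp
    finally have a: "a \<in> R \<one>" .
    have ae: "a * e = a"
      using e u(2)[OF h] unfolding a_def by (metis commute mult.assoc)
    have au: "a * u ?k = u g * u h"
      using u(2)[OF h] by (simp add: a_def mult.assoc vu)
    obtain t where t: "t \<noteq> 0" "(u g * u h) ^ ?n = scale t (u g ^ ?n * u h ^ ?n)"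
      using power_order_mult[OF g h u(1)[OF g] u(1)[OF h]] .
    have "scale (l ?k) (a ^ ?n) = (a * u ?k) ^ ?n"
    proof -
      have "a ^ ?n * e = a ^ ?n"
        using power_mult_C[OF a, of e ?n] ae e order_pos by (simp add: power_idempotent)
      then show ?thesis
        using a u(4)[OF k] by (simp add: power_mult_C scale_mult_right)
    qed
    also have "\<dots> = scale (t * l g * l h) e"
      using t u(4)[OF g] u(4)[OF h] e by (simp add: au scale_mult_left scale_mult_right)
    finally have "scale (1 / l ?k) (scale (l ?k) (a ^ ?n)) = scale (1 / l ?k) (scale (t * l g * l h) e)"
      by simp
    then have pow: "a ^ ?n = scale (t * l g * l h / l ?k) e" "t * l g * l h / l ?k \<noteq> 0"
      using u(3) g h k t(1) by simp_all
    obtain c m where "(a - scale c e) ^ m = 0"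
      using loc[OF a ae] by blast
    then have c: "a = scale c e"
      using scalar_if_power_scalar[OF _ e a ae _ pow] order_pos by auto
    then have "c \<noteq> 0"
      using pow e(3) order_pos by (auto simp: power_0_left)
    moreover have "u g * u h = scale c (u ?k)"
      using au c u(2)[OF k] commute[OF e(1)] by (metis scale_mult_left)
    ultimately show ?thesis
      by blast
  qed
  then obtain \<alpha> where "\<And>g h. g \<in> carrier G \<Longrightarrow> h \<in> carrier G \<Longrightarrow>
      \<alpha> g h \<noteq> 0 \<and> u g * u h = scale (\<alpha> g h) (u (g \<otimes> h))"
    by metis
  moreover have "u g \<noteq> 0" if "g \<in> carrier G" for g
    using u(3,4)[OF that] e(3) order_pos by (auto simp: power_0_left)
  ultimately have "twisted_basis_family G scale R u \<alpha>"
    using u(1) by unfold_locales auto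
  then show ?thesis
    by (rule that)
qed

end

theorem proposition14:
  fixes G :: "('g, 'm) monoid_scheme"
    and scale :: "'k::{alg_closed_field, field_char_0} \<Rightarrow> 'r::ring_1 \<Rightarrow> 'r"
    and R :: "'g \<Rightarrow> 'r set"
    and \<theta> :: "'g list \<Rightarrow> (nat \<Rightarrow> nat) \<Rightarrow> 'k"
  assumes "finite (carrier G)"
    and "graded_regular_algebra G scale R \<theta>"
    and "\<exists>B. finite_dimensional_vector_space scale B"
  shows "\<exists>\<alpha> S \<phi>. two_cocycle G \<alpha> \<and> K_algebra.subalgebra scale S \<and>
    K_algebra.twisted_group_algebra_iso scale G \<alpha> S \<phi>"
proof -
  obtain B where B: "finite_dimensional_vector_space scale B"
    using assms(3) by blast
  interpret graded_regular_algebra G scale R \<theta>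
    by (rule assms(2))
  interpret finite_dimensional_vector_space scale B
    by (rule B)
  interpret fd_graded_regular_algebra G scale R \<theta> B
    by unfold_locales (rule assms(1))
  obtain u \<alpha> where "twisted_basis_family G scale R u \<alpha>"
    by (rule ex_twisted_basis_family)
  then interpret twisted_basis_family G scale R u \<alpha> .
  show ?thesis
    using two_cocycle_\<alpha> subalgebra_embed twisted_group_algebra_iso_embed by blast
qed

end
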